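(* Let $K$ be a simplicial complex on the vertex set $[m]=\{1,\dots,m\}$, let $\sigma\in K$ be a simplex, and let $\mathbb{P}=\{\sigma_1,\sigma_2,\dots,\sigma_s\}$ be a simplicial complement of $K$. Then \[ \{\mathbb{P},\ \sigma,\ (\mathbb{P}-\sigma)\ast(m+1)\} \] is a simplicial complement of the stellar subdivision $ss_\sigma K$ on the vertex set $[m+1]$. Here this notation denotes the collection of subsets of $[m+1]$ consisting of $\sigma_1,\dots,\sigma_s$, of $\sigma$, and of the members of \[ (\mathbb{P}-\sigma)\ast(m+1)=\{(\sigma_1\setminus\sigma)\cup\{m+1\},\ (\sigma_2\setminus\sigma)\cup\{m+1\},\ \dots,\ (\sigma_s\setminus\sigma)\cup\{m+1\}\}. \]
   Context: An abstract simplicial complex on a finite vertex set $I$ is a collection of subsets of $I$ (simplices, or faces) closed under taking subsets; elements of $I$ need not be vertices of the complex. A non-face of $K$ is a subset of $I$ not in $K$; a missing face is a non-face all of whose proper subsets are in $K$. A simplicial complement of $K$ on $I$ is a collection $\mathbb{P}$ of non-faces of $K$ (subsets of $I$) that contains all missing faces of $K$; equivalently, $K=\{\tau\subseteq I\mid \tau \text{ contains no } \sigma_i\in\mathbb{P}\}$. Stellar subdivision: for a complex $K$ on $[m]$ and a simplex $\sigma\in K$, put $Intstar_K\sigma=\{\tau\in K\mid \sigma\subseteq\tau\}$ and $\partial star_K\sigma=\{\tau\in K\mid \sigma\cup\tau\in K,\ \sigma\not\subseteq\tau\}$. The stellar subdivision of $K$ at $\sigma$ is the complex on $[m+1]$ \[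 ss_\sigma K=(K\setminus Intstar_K\sigma)\cup (cone\,\partial star_K\sigma), \] where $cone\,\partial star_K\sigma=\{\tau,\ \tau\cup\{m+1\}\mid \tau\in\partial star_K\sigma\}$. *)

theory Defs
  imports Main
begin

text \<open>
  Abstract simplicial complexes on a vertex set \<open>I\<close>. Elements of \<open>I\<close> need not be vertices
  of the complex, and both \<open>{}\<close> and \<open>{{}}\<close> count as complexes; the former arises as the
  stellar subdivision of any complex at the empty simplex.
\<close>

definition simplicial_complex_on :: "'a set \<Rightarrow> 'a set set \<Rightarrow> bool" where
  "simplicial_complex_on I K \<longleftrightarrow>
     finite I \<and> K \<subseteq> Pow I \<and> (\<forall>\<tau>\<in>K. \<forall>\<rho>. \<rho> \<subseteq> \<tau> \<longrightarrow> \<rho> \<in> K)"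

definition non_faces :: "'a set \<Rightarrow> 'a set set \<Rightarrow> 'a set set" where
  "non_faces I K = {\<tau>. \<tau> \<subseteq> I \<and> \<tau> \<notin> K}"

definition missing_faces :: "'a set \<Rightarrow> 'a set set \<Rightarrow> 'a set set" where
  "missing_faces I K = {\<tau> \<in> non_faces I K. \<forall>\<rho>. \<rho> \<subset> \<tau> \<longrightarrow> \<rho> \<in> K}"

definition simplicial_complement :: "'a set \<Rightarrow> 'a set set \<Rightarrow> 'a set set \<Rightarrow> bool" where
  "simplicial_complement I K P \<longleftrightarrow> P \<subseteq> non_faces I K \<and> missing_faces I K \<subseteq> P"

definition Intstar :: "'a set set \<Rightarrow> 'a set \<Rightarrow> 'a set set" where
  "Intstar K \<sigma> = {\<tau> \<in> K. \<sigma> \<subseteq> \<tau>}"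

definition bdry_star :: "'a set set \<Rightarrow> 'a set \<Rightarrow> 'a set set" where
  "bdry_star K \<sigma> = {\<tau> \<in> K. \<sigma> \<union> \<tau> \<in> K \<and> \<not> \<sigma> \<subseteq> \<tau>}"

definition cone :: "'a \<Rightarrow> 'a set set \<Rightarrow> 'a set set" where
  "cone v L = L \<union> (\<lambda>\<tau>. \<tau> \<union> {v}) ` L"

text \<open>The new vertex \<open>v\<close> is a parameter; it is meant to lie outside the vertex set of \<open>K\<close>.\<close>

definition stellar_subdivision :: "'a \<Rightarrow> 'a set \<Rightarrow> 'a set set \<Rightarrow> 'a set set" where
  "stellar_subdivision v \<sigma> K = (K - Intstar K \<sigma>) \<union> cone v (bdry_star K \<sigma>)"

text \<open>The collection \<open>(P - \<sigma>) * v\<close>.\<close>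

definition diff_join :: "'a set set \<Rightarrow> 'a set \<Rightarrow> 'a \<Rightarrow> 'a set set" where
  "diff_join P \<sigma> v = (\<lambda>\<sigma>\<^sub>i. (\<sigma>\<^sub>i - \<sigma>) \<union> {v}) ` P"

lemma simplicial_complement_iff:
  assumes "simplicial_complex_on I K" and "P \<subseteq> Pow I"
  shows "simplicial_complement I K P \<longleftrightarrow> K = {\<tau>. \<tau> \<subseteq> I \<and> (\<forall>\<rho>\<in>P. \<not> \<rho> \<subseteq> \<tau>)}"
proof
  assume c: "simplicial_complement I K P"
  have "\<exists>\<rho>\<in>P. \<rho> \<subseteq> \<tau>" if "\<tau> \<subseteq> I" "\<tau> \<notin> K" for \<tau>
  proof -
    have "finite \<tau>"
      using that assms(1) finite_subset unfolding simplicial_complex_on_def by blast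
    then show ?thesis using that
    proof (induction \<tau> rule: finite_psubset_induct)
      case (psubset \<tau>)
      show ?case
      proof (cases "\<tau> \<in> missing_faces I K")
        case True
        then show ?thesis using c unfolding simplicial_complement_def by blast
      next
        case False
        then obtain \<rho> where "\<rho> \<subset> \<tau>" "\<rho> \<notin> K"
          using psubset.prems unfolding missing_faces_def non_faces_def by blast
        then show ?thesis using psubset.IH[of \<rho>] psubset.prems by blast
      qed
    qed
  qed
  moreover have "\<tau> \<subseteq> I" if "\<tau> \<in> K" for \<tau>
    using assms(1) that unfolding simplicial_complex_on_def by auto
  moreover have "\<not> \<rho> \<subseteq> \<tau>" if "\<tau> \<in> K" "\<rho> \<in> P" for \<rho> \<tau>
  proof -
    have "\<rho> \<notin> K" using c that(2) unfolding simplicial_complement_def non_faces_def by auto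
    then show ?thesis using assms(1) that(1) unfolding simplicial_complex_on_def by metis
  qed
  ultimately show "K = {\<tau>. \<tau> \<subseteq> I \<and> (\<forall>\<rho>\<in>P. \<not> \<rho> \<subseteq> \<tau>)}"
    by (intro set_eqI) (unfold mem_Collect_eq, metis)
next
  assume K: "K = {\<tau>. \<tau> \<subseteq> I \<and> (\<forall>\<rho>\<in>P. \<not> \<rho> \<subseteq> \<tau>)}"
  have "P \<subseteq> non_faces I K"
    using assms(2) unfolding non_faces_def by (subst K) auto
  moreover have "\<tau> \<in> P" if t: "\<tau> \<in> missing_faces I K" for \<tau>
  proof -
    have "\<tau> \<subseteq> I" "\<tau> \<notin> K" using t unfolding missing_faces_def non_faces_def by auto
    then obtain \<rho> where r: "\<rho> \<in> P" "\<rho> \<subseteq> \<tau>" by (subst (asm) K) auto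
    have "\<rho> \<notin> K" using r(1) by (subst K) auto
    then have "\<rho> = \<tau>" using t r(2) unfolding missing_faces_def by blast
    then show ?thesis using r(1) by simp
  qed
  ultimately show "simplicial_complement I K P"
    unfolding simplicial_complement_def by blast
qed

lemma simplicial_complex_on_stellar_subdivision:
  assumes K: "simplicial_complex_on I K" and v: "v \<notin> I"
  shows "simplicial_complex_on (insert v I) (stellar_subdivision v \<sigma> K)"
proof -
  have sub: "\<tau> \<subseteq> I" if "\<tau> \<in> K" for \<tau>
    using K that unfolding simplicial_complex_on_def by blast
  have down: "\<rho> \<in> K" if "\<tau> \<in> K" "\<rho> \<subseteq> \<tau>" for \<rho> \<tau>
    using K that unfolding simplicial_complex_on_def by blast
  have bdown: "\<rho> \<in> bdry_star K \<sigma>" if t: "\<tau> \<in> bdry_star K \<sigma>" and r: "\<rho> \<subseteq> \<tau>" for \<rho> \<tau>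
  proof -
    have "\<tau> \<in> K" "\<sigma> \<union> \<tau> \<in> K" "\<not> \<sigma> \<subseteq> \<tau>" using t unfolding bdry_star_def by auto
    then have "\<rho> \<in> K" "\<sigma> \<union> \<rho> \<in> K" "\<not> \<sigma> \<subseteq> \<rho>"
      using r down[of \<tau> \<rho>] down[of "\<sigma> \<union> \<tau>" "\<sigma> \<union> \<rho>"] by auto
    then show ?thesis unfolding bdry_star_def by simp
  qed
  have "\<rho> \<in> stellar_subdivision v \<sigma> K"
    if t: "\<tau> \<in> stellar_subdivision v \<sigma> K" and r: "\<rho> \<subseteq> \<tau>" for \<rho> \<tau>
  proof -
    consider "\<tau> \<in> K" "\<not> \<sigma> \<subseteq> \<tau>" | "\<tau> \<in> bdry_star K \<sigma>"
      | \<tau>' where "\<tau>' \<in> bdry_star K \<sigma>" "\<tau> = \<tau>' \<union> {v}"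
      using t unfolding stellar_subdivision_def cone_def Intstar_def by blast
    then show ?thesis
    proof cases
      case 1
      then have "\<rho> \<in> K" "\<not> \<sigma> \<subseteq> \<rho>" using down r by blast+
      then show ?thesis unfolding stellar_subdivision_def Intstar_def by blast
    next
      case 2
      then show ?thesis using bdown r unfolding stellar_subdivision_def cone_def by blast
    next
      case 3
      have b: "\<rho> - {v} \<in> bdry_star K \<sigma>" using bdown[OF 3(1)] r 3(2) by blast
      have "\<rho> = \<rho> - {v} \<or> \<rho> = (\<rho> - {v}) \<union> {v}" by auto
      then have "\<rho> \<in> cone v (bdry_star K \<sigma>)"
        using b unfolding cone_def by (metis UnCI imageI)
      then show ?thesis unfolding stellar_subdivision_def by simp
    qed
  qed
  moreover have "stellar_subdivision v \<sigma> K \<subseteq> Pow (insert v I)"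
    using sub unfolding stellar_subdivision_def cone_def bdry_star_def by blast
  ultimately show ?thesis
    using K unfolding simplicial_complex_on_def by blast
qed

end

theory Submission
  imports Defs
begin

text \<open>
  By \<open>simplicial_complement_iff\<close> it suffices to decide which \<open>\<tau>\<close> lie in the subdivision. If
  \<open>v \<notin> \<tau>\<close>, these are the faces of \<open>K\<close> not containing \<open>\<sigma>\<close>. If \<open>v \<in> \<tau>\<close>, then
  \<open>\<tau> - {v}\<close> must lie in the boundary of the star; there \<open>\<sigma> \<union> (\<tau> - {v}) \<in> K\<close>
  says that no \<open>\<rho> \<in> P\<close> is contained in \<open>\<sigma> \<union> (\<tau> - {v})\<close>, that is,
  \<open>(\<rho> - \<sigma>) \<union> {v}\<close> is not contained in \<open>\<tau>\<close>.
\<close>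

text \<open>Every set \<open>\<tau> \<union> {v}\<close> added by the cone contains
  \<open>v\<close>, and the base \<open>bdry_star K \<sigma>\<close> of the cone already lies in
  \<open>K - Intstar K \<sigma>\<close>.\<close>

lemma stellar_subdivision_iff_notin:
  assumes "v \<notin> \<tau>"
  shows "\<tau> \<in> stellar_subdivision v \<sigma> K \<longleftrightarrow> \<tau> \<in> K \<and> \<not> \<sigma> \<subseteq> \<tau>"
  using assms unfolding stellar_subdivision_def Intstar_def cone_def bdry_star_def by auto

text \<open>No face of \<open>K\<close> contains \<open>v\<close>, so \<open>\<tau>\<close> can only
  come from the apex part of the cone, and deleting \<open>v\<close> recovers the base face.\<close>

lemma stellar_subdivision_iff_in:
  assumes K: "K \<subseteq> Pow I" and v: "v \<notin> I" "v \<in> \<tau>"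
  shows "\<tau> \<in> stellar_subdivision v \<sigma> K \<longleftrightarrow> \<tau> - {v} \<in> bdry_star K \<sigma>"
proof -
  have out: "v \<notin> \<rho>" if "\<rho> \<in> K" for \<rho>
    using K v(1) that by blast
  have bK: "\<rho> \<in> K" if "\<rho> \<in> bdry_star K \<sigma>" for \<rho>
    using that unfolding bdry_star_def by simp
  have "\<tau> \<notin> K" using out v(2) by blast
  then have "\<tau> \<in> stellar_subdivision v \<sigma> K \<longleftrightarrow> (\<exists>\<rho>\<in>bdry_star K \<sigma>. \<tau> = \<rho> \<union> {v})"
    using bK unfolding stellar_subdivision_def cone_def by blast
  also have "\<dots> \<longleftrightarrow> \<tau> - {v} \<in> bdry_star K \<sigma>"
  proof
    assume "\<exists>\<rho>\<in>bdry_star K \<sigma>. \<tau> = \<rho> \<union> {v}"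
    then obtain \<rho> where "\<rho> \<in> bdry_star K \<sigma>" "\<tau> = \<rho> \<union> {v}" by blast
    moreover from this have "\<tau> - {v} = \<rho>" using out bK by blast
    ultimately show "\<tau> - {v} \<in> bdry_star K \<sigma>" by simp
  next
    assume "\<tau> - {v} \<in> bdry_star K \<sigma>"
    then show "\<exists>\<rho>\<in>bdry_star K \<sigma>. \<tau> = \<rho> \<union> {v}"
      using v(2) by (intro bexI[of _ "\<tau> - {v}"]) auto
  qed
  finally show ?thesis .
qed

lemma simplicial_complement_stellar_subdivision:
  assumes K: "simplicial_complex_on I K" and v: "v \<notin> I" and \<sigma>: "\<sigma> \<in> K"
    and P: "simplicial_complement I K P"
  shows "simplicial_complement (insert v I) (stellar_subdivision v \<sigma> K)
           (P \<union> {\<sigma>} \<union> diff_join P \<sigma> v)"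
proof -
  let ?S = "stellar_subdivision v \<sigma> K" and ?Q = "P \<union> {\<sigma>} \<union> diff_join P \<sigma> v"
  have KI: "K \<subseteq> Pow I" using K unfolding simplicial_complex_on_def by blast
  have PI: "P \<subseteq> Pow I" using P unfolding simplicial_complement_def non_faces_def by blast
  have \<sigma>I: "\<sigma> \<subseteq> I" using KI \<sigma> by blast
  have K_eq: "K = {\<tau>. \<tau> \<subseteq> I \<and> (\<forall>\<rho>\<in>P. \<not> \<rho> \<subseteq> \<tau>)}"
    using simplicial_complement_iff[OF K PI] P by blast
  then have K_iff: "\<tau> \<in> K \<longleftrightarrow> \<tau> \<subseteq> I \<and> (\<forall>\<rho>\<in>P. \<not> \<rho> \<subseteq> \<tau>)" for \<tau>
    by blast
  have S_sub: "?S \<subseteq> Pow (insert v I)"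
    using simplicial_complex_on_stellar_subdivision[OF K v, of \<sigma>]
    unfolding simplicial_complex_on_def by blast
  have Q_sub: "?Q \<subseteq> Pow (insert v I)"
    using PI \<sigma>I unfolding diff_join_def by blast
  have "\<tau> \<in> ?S \<longleftrightarrow> (\<forall>\<rho>\<in>?Q. \<not> \<rho> \<subseteq> \<tau>)" if \<tau>: "\<tau> \<subseteq> insert v I" for \<tau>
  proof (cases "v \<in> \<tau>")
    case False
    then have "\<tau> \<subseteq> I" using \<tau> by blast
    \<comment> \<open>Each member of \<open>diff_join P \<sigma> v\<close> contains
      \<open>v\<close>, so it imposes no condition on this \<open>\<tau>\<close>.\<close>
    then show ?thesis
      using False unfolding stellar_subdivision_iff_notin[OF False] K_iff diff_join_def by auto
  next
    case True
    have "\<tau> - {v} \<subseteq> I" using \<tau> by blast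
    moreover have "\<rho> \<subseteq> \<tau> - {v} \<longleftrightarrow> \<rho> \<subseteq> \<tau>" if "\<rho> \<subseteq> I" for \<rho>
      using that v by blast
    moreover have "\<rho> \<subseteq> \<sigma> \<union> (\<tau> - {v}) \<longleftrightarrow> (\<rho> - \<sigma>) \<union> {v} \<subseteq> \<tau>" if "\<rho> \<in> P" for \<rho>
      using that PI v True by blast
    \<comment> \<open>The three conditions defining \<open>bdry_star\<close> match the three parts
      of \<open>?Q\<close>: being in \<open>K\<close> gives \<open>P\<close>, the union with
      \<open>\<sigma>\<close> being in \<open>K\<close> gives \<open>diff_join P \<sigma> v\<close>,
      and not containing \<open>\<sigma>\<close> gives \<open>{\<sigma>}\<close>.\<close>
    ultimately show ?thesis
      using PI \<sigma>I
      unfolding stellar_subdivision_iff_in[OF KI v True] bdry_star_def mem_Collect_eq K_iff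
        diff_join_def
      by (simp add: ball_Un Pow_def subset_eq[of P]) blast
  qed
  then have "?S = {\<tau>. \<tau> \<subseteq> insert v I \<and> (\<forall>\<rho>\<in>?Q. \<not> \<rho> \<subseteq> \<tau>)}"
    using S_sub by blast
  then show ?thesis
    using simplicial_complement_iff[OF simplicial_complex_on_stellar_subdivision[OF K v] Q_sub]
    by blast
qed

theorem theorem2p9:
  fixes m :: nat and K P :: "nat set set" and \<sigma> :: "nat set"
  assumes "simplicial_complex_on {1..m} K"
    and "\<sigma> \<in> K"
    and "simplicial_complement {1..m} K P"
  shows "simplicial_complement {1..m + 1} (stellar_subdivision (m + 1) \<sigma> K)
           (P \<union> {\<sigma>} \<union> diff_join P \<sigma> (m + 1))"
proof -
  have "{1..m + 1} = insert (m + 1) {1..m}" by auto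
  then show ?thesis
    using simplicial_complement_stellar_subdivision[OF assms(1) _ assms(2,3), of "m + 1"] by simp
qed

end
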